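(* Let $\mathbb{X}$ be a finite dimensional real inner product space with induced norm $\|\cdot\|$, and let $\Phi:\mathbb{X}\to(-\infty,\infty]$ be a proper lower semicontinuous function that is coercive and bounded below. Let $m\ge 0$ be an integer, $a>0$, $b>0$, and let $\{x^k\}_{k\in\mathbb{N}}\subset\mathbb{X}$ be a sequence such that for each $k\in\mathbb{N}$: (H1) $\Phi(x^{k+1})+a\|x^{k+1}-x^k\|^2\le\max_{j=[k-m]_+,\ldots,k}\Phi(x^j)$; (H2) there exists $w^k\in\partial\Phi(x^k)$ such that $\|w^{k+1}\|\le b\|x^{k+1}-x^k\|$. Let $\omega(x^0)$ be the set of cluster points of $\{x^k\}_{k\in\mathbb{N}}$. Suppose that $\Phi$ is a KL function, that $\liminf_{k\to\infty}\Phi(x^k)\ge\lim_{k\to\infty}\Phi(x^{\ell(k)})$, that $\limsup_{j\to\infty}\Phi(x^{k_j})\le\Phi(\widehat{x})$ for each subsequence $\{x^{k_j}\}_{j\in\mathbb{N}}$ with $\lim_{j\to\infty}x^{k_j}=\widehat{x}$, and that for some $\rho>0$ the function $\Phi$ is $\rho$-weakly convex on a neighborhood of $\omega(x^0)$. Let $$K_1:=\Big\{k\in\mathbb{N}\ \big|\ \Phi(x^{\ell(k+1)})-\Phi(x^{k+1})\ge\tfrac{a}{2}\|x^{k+1}-x^k\|^2\Big\}.$$ Then $\sum_{k=0}^\infty\|x^{k+1}-x^k\|<\infty$ if and only if the following condition holds: $$\sum_{k\in K_1}\sqrt{\Phi(x^{\ell(k+1)})-\Phi(x^{k+1})}<\infty\quad\text{whenever}\quad\liminf_{K_1\ni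 k\to\infty}\frac{\Phi(x^{\ell(k)})-\Phi(x^{\ell(k+1)})}{\|x^{k+1}-x^k\|^2}=0 .$$
   Context: $[t]_+:=\max(0,t)$. For each $k$, $\ell(k)$ denotes the largest index in $\arg\max_{j=[k-m]_+,\ldots,k}\Phi(x^j)$ (under (H1), $\{\Phi(x^{\ell(k)})\}$ is nonincreasing, so its limit exists). $\partial\Phi$ denotes the limiting (Mordukhovich) subdifferential; it is considered only at points of $\mathrm{dom}\,\Phi$. $\Phi$ is $\rho$-weakly convex on a set $\mathcal{N}$ if $x\mapsto\Phi(x)+\frac{\rho}{2}\|x\|^2$ is convex on $\mathcal{N}$, i.e. satisfies the convexity inequality along every line segment contained in $\mathcal{N}$. KL property: for $\eta\in(0,\infty]$, let $\Upsilon_\eta$ be the family of continuous concave $\varphi:[0,\eta)\to\mathbb{R}_+$ that are continuously differentiable on $(0,\eta)$ with $\varphi'>0$ there and $\varphi(0)=0$. A proper lsc $h$ has the KL property at $\overline{x}\in\mathrm{dom}\,\partial h$ if there exist $\eta\in(0,\infty]$, a neighborhood $\mathcal{U}$ of $\overline{x}$ and $\varphi\in\Upsilon_\eta$ such that $\varphi'(h(x)-h(\overline{x}))\,\mathrm{dist}(0,\partial h(x))\ge1$ for all $x\in\mathcal{U}$ with $h(\overline{x})<h(x)<h(\overline{x})+\eta$. $h$ is a KL function if it has the KL property at every point of $\mathrm{dom}\,\partial h$. Convention: the quotient with denominator $\|x^{k+1}-x^k\|^2$ is read as $+\infty$ when $x^{k+1}=x^k$, and a liminf over a finite index set is $+\infty$.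 *)

theory Defs
  imports "HOL-Analysis.Analysis"
begin

section \<open>Extended-real-valued functions\<close>

definition proper :: "('a \<Rightarrow> ereal) \<Rightarrow> bool" where
  "proper h \<longleftrightarrow> (\<forall>x. h x \<noteq> -\<infinity>) \<and> (\<exists>x. h x \<noteq> \<infinity>)"

definition lsc :: "('a::topological_space \<Rightarrow> ereal) \<Rightarrow> bool" where
  "lsc h \<longleftrightarrow> (\<forall>x. h x \<le> Liminf (at x) h)"

definition coercive :: "('a::real_normed_vector \<Rightarrow> ereal) \<Rightarrow> bool" where
  "coercive h \<longleftrightarrow> (h \<longlongrightarrow> \<infinity>) at_infinity"

definition bounded_from_below :: "('a \<Rightarrow> ereal) \<Rightarrow> bool" where
  "bounded_from_below h \<longleftrightarrow> (\<exists>c::real. \<forall>x. ereal c \<le> h x)"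

definition edom :: "('a \<Rightarrow> ereal) \<Rightarrow> 'a set" where
  "edom h = {x. h x < \<infinity>}"

section \<open>Subdifferentials\<close>

definition regular_subdiff :: "('a::real_inner \<Rightarrow> ereal) \<Rightarrow> 'a \<Rightarrow> 'a set" where
  "regular_subdiff h x =
     {v. x \<in> edom h \<and>
         0 \<le> Liminf (at x) (\<lambda>y. (h y - h x - ereal (v \<bullet> (y - x))) / ereal (norm (y - x)))}"

text \<open>The limiting (Mordukhovich) subdifferential, which is empty outside the effective domain.\<close>

definition limiting_subdiff :: "('a::real_inner \<Rightarrow> ereal) \<Rightarrow> 'a \<Rightarrow> 'a set" where
  "limiting_subdiff h x =
     {v. x \<in> edom h \<and>
         (\<exists>u w. u \<longlonglongrightarrow> x \<and> (\<lambda>n. h (u n)) \<longlonglongrightarrow> h x \<and>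
                (\<forall>n. w n \<in> regular_subdiff h (u n)) \<and> w \<longlonglongrightarrow> v)}"

definition dom_subdiff :: "('a::real_inner \<Rightarrow> ereal) \<Rightarrow> 'a set" where
  "dom_subdiff h = {x. limiting_subdiff h x \<noteq> {}}"

section \<open>The Kurdyka--Lojasiewicz property\<close>

text \<open>Distance of the origin to a set. Unlike \<open>infdist\<close>, it is \<open>\<infinity>\<close> for the empty set.\<close>

definition edist0 :: "'a::real_normed_vector set \<Rightarrow> ereal" where
  "edist0 S = (INF v\<in>S. ereal (norm v))"

text \<open>Only the values on the interval from \<open>0\<close> (included) to \<open>\<eta>\<close> (excluded) matter.\<close>

definition desingularizing :: "ereal \<Rightarrow> (real \<Rightarrow> real) \<Rightarrow> bool" where
  "desingularizing \<eta> \<phi> \<longleftrightarrow>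
     (\<forall>t\<in>{t. 0 \<le> t \<and> ereal t < \<eta>}. 0 \<le> \<phi> t) \<and>
     continuous_on {t. 0 \<le> t \<and> ereal t < \<eta>} \<phi> \<and>
     concave_on {t. 0 \<le> t \<and> ereal t < \<eta>} \<phi> \<and>
     (\<forall>t\<in>{t. 0 < t \<and> ereal t < \<eta>}. \<phi> differentiable (at t)) \<and>
     continuous_on {t. 0 < t \<and> ereal t < \<eta>} (deriv \<phi>) \<and>
     (\<forall>t\<in>{t. 0 < t \<and> ereal t < \<eta>}. 0 < deriv \<phi> t) \<and>
     \<phi> 0 = 0"

text \<open>The condition on \<open>x\<close> below forces \<open>h x - h xbar\<close> to be finite, so that
  \<open>real_of_ereal\<close> is harmless.\<close>

definition KL_property_at :: "('a::real_inner \<Rightarrow> ereal) \<Rightarrow> 'a \<Rightarrow> bool" where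
  "KL_property_at h xbar \<longleftrightarrow>
     (\<exists>\<eta> U \<phi>. 0 < \<eta> \<and> xbar \<in> interior U \<and> desingularizing \<eta> \<phi> \<and>
        (\<forall>x\<in>U. h xbar < h x \<and> h x < h xbar + \<eta> \<longrightarrow>
           1 \<le> ereal (deriv \<phi> (real_of_ereal (h x - h xbar))) * edist0 (limiting_subdiff h x)))"

definition KL_function :: "('a::real_inner \<Rightarrow> ereal) \<Rightarrow> bool" where
  "KL_function h \<longleftrightarrow> proper h \<and> lsc h \<and> (\<forall>x\<in>dom_subdiff h. KL_property_at h x)"

section \<open>Weak convexity\<close>

text \<open>The set need not be convex: only segments contained in it are considered.\<close>

definition weakly_convex_on ::
  "real \<Rightarrow> 'a::real_normed_vector set \<Rightarrow> ('a \<Rightarrow> ereal) \<Rightarrow> bool" where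
  "weakly_convex_on \<rho> N h \<longleftrightarrow>
     (let g = (\<lambda>x. h x + ereal (\<rho> / 2 * (norm x)\<^sup>2)) in
      \<forall>x y. closed_segment x y \<subseteq> N \<longrightarrow>
        (\<forall>t\<in>{0..1}. g ((1 - t) *\<^sub>R x + t *\<^sub>R y) \<le> ereal (1 - t) * g x + ereal t * g y))"

section \<open>Sequences\<close>

definition cluster_points :: "(nat \<Rightarrow> 'a::topological_space) \<Rightarrow> 'a set" where
  "cluster_points x = {z. \<exists>r. strict_mono r \<and> (x \<circ> r) \<longlonglongrightarrow> z}"

text \<open>Truncated subtraction on \<open>nat\<close> gives exactly the positive part of \<open>k - m\<close>.\<close>

definition window :: "nat \<Rightarrow> nat \<Rightarrow> nat set" where
  "window m k = {k - m..k}"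

definition ell :: "('a \<Rightarrow> ereal) \<Rightarrow> nat \<Rightarrow> (nat \<Rightarrow> 'a) \<Rightarrow> nat \<Rightarrow> nat" where
  "ell h m x k = Max {j \<in> window m k. \<forall>i\<in>window m k. h (x i) \<le> h (x j)}"

definition K1 :: "('a::real_normed_vector \<Rightarrow> ereal) \<Rightarrow> nat \<Rightarrow> real \<Rightarrow> (nat \<Rightarrow> 'a) \<Rightarrow> nat set" where
  "K1 h m a x =
     {k. ereal (a / 2 * (norm (x (Suc k) - x k))\<^sup>2) \<le> h (x (ell h m x (Suc k))) - h (x (Suc k))}"

text \<open>The case distinction is needed because \<open>0 / 0 = 0\<close> in \<open>ereal\<close>.\<close>

definition decrease_quotient ::
  "('a::real_normed_vector \<Rightarrow> ereal) \<Rightarrow> nat \<Rightarrow> (nat \<Rightarrow> 'a) \<Rightarrow> nat \<Rightarrow> ereal" where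
  "decrease_quotient h m x k =
     (if x (Suc k) = x k then \<infinity>
      else (h (x (ell h m x k)) - h (x (ell h m x (Suc k)))) / ereal ((norm (x (Suc k) - x k))\<^sup>2))"

text \<open>Lower limit along an index set. For a finite set the filter is \<open>bot\<close> and the value is \<open>\<infinity>\<close>.\<close>

definition liminf_along :: "nat set \<Rightarrow> (nat \<Rightarrow> ereal) \<Rightarrow> ereal" where
  "liminf_along K q = Liminf (inf sequentially (principal K)) q"

end

theory Submission
  imports Defs
begin

text \<open>
  Let \<open>L k\<close> be the maximum of \<open>\<Phi>\<close> over the window ending at \<open>k\<close>. Outside \<open>K1\<close>, or when the
  quotient has a positive lower limit along \<open>K1\<close>, the decrease \<open>L k - L (Suc k)\<close> dominates a
  multiple of the squared step; the KL inequality at the iterate realizing \<open>L k\<close> and AM-GM then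
  bound the step by a small multiple of the preceding \<open>m + 2\<close> steps plus a telescoping term, and such
  a recursion forces summability. On \<open>K1\<close> the step is bounded by a multiple of the square root of
  the gap \<open>L (Suc k) - \<Phi> (x (Suc k))\<close>. Conversely, summable steps make the iterates
  converge, and the subgradient inequality of a weakly convex function, applied at the iterate
  realizing \<open>L (Suc k)\<close>, bounds the gap by a multiple of the square of the sum of the last \<open>m + 1\<close>
  steps.
\<close>

section \<open>Window sums and recursions that force summability\<close>

text \<open>After exchanging the sums, \<open>d j\<close> is counted once per window containing
  \<open>j\<close>, and such windows end between \<open>j\<close> and \<open>j + m\<close>.\<close>

lemma sum_window_sum_le:
  fixes d :: "nat \<Rightarrow> real"
  assumes "\<And>k. 0 \<le> d k"
  shows "(\<Sum>k<n. \<Sum>j\<in>window m k. d j) \<le> (real m + 1) * (\<Sum>j<n. d j)"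
proof -
  have "(\<Sum>k<n. \<Sum>j\<in>window m k. d j) = (\<Sum>k<n. \<Sum>j | j \<in> {..<n} \<and> j \<in> window m k. d j)"
    by (intro sum.cong refl arg_cong2[where f = sum]) (auto simp: window_def)
  also have "\<dots> = (\<Sum>j<n. \<Sum>k | k \<in> {..<n} \<and> j \<in> window m k. d j)"
    by (rule sum.swap_restrict) auto
  also have "\<dots> \<le> (\<Sum>j<n. (real m + 1) * d j)"
  proof (rule sum_mono)
    fix j assume "j \<in> {..<n}"
    have "card {k \<in> {..<n}. j \<in> window m k} \<le> card {j..j + m}"
      by (rule card_mono) (auto simp: window_def)
    then have "real (card {k \<in> {..<n}. j \<in> window m k}) \<le> real m + 1"
      by simp
    then show "(\<Sum>k | k \<in> {..<n} \<and> j \<in> window m k. d j) \<le> (real m + 1) * d j"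
      using assms[of j] by (simp add: mult_right_mono)
  qed
  finally show ?thesis
    by (simp add: sum_distrib_left)
qed

lemma summable_window_sum:
  fixes d :: "nat \<Rightarrow> real"
  assumes "\<And>k. 0 \<le> d k" "summable d"
  shows "summable (\<lambda>k. \<Sum>j\<in>window m k. d j)"
proof (rule summableI_nonneg_bounded)
  show "0 \<le> (\<Sum>j\<in>window m k. d j)" for k
    by (simp add: assms sum_nonneg)
  show "(\<Sum>k<n. \<Sum>j\<in>window m k. d j) \<le> (real m + 1) * suminf d" for n
    by (rule order_trans[OF sum_window_sum_le[OF assms(1)]])
      (intro mult_left_mono sum_le_suminf assms, auto simp: assms)
qed

text \<open>Summing the recursion over \<open>k < n\<close> bounds the partial sum by a constant
  plus \<open>c * (m + 1)\<close> times itself; as that factor is below 1, it is absorbed on the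
  left, uniformly in \<open>n\<close>.\<close>

lemma summable_of_window_recursion:
  fixes d e :: "nat \<Rightarrow> real"
  assumes d: "\<And>k. 0 \<le> d k" and e: "\<And>k. k \<ge> k0 \<Longrightarrow> 0 \<le> e k" and "summable e"
    and c: "0 \<le> c" "c * (real m + 1) < 1"
    and rec: "\<And>k. k \<ge> k0 \<Longrightarrow> d k \<le> e k + c * (\<Sum>j\<in>window m k. d j)"
  shows "summable d"
proof (rule summableI_nonneg_bounded)
  \<comment> \<open>Using \<open>d\<close> in place of \<open>e\<close> below \<open>k0\<close>
    makes the recursion valid for every \<open>k\<close>, since the window term is nonnegative, and
    alters only finitely many terms.\<close>
  define e' where "e' k = (if k < k0 then d k else e k)" for k
  have e': "0 \<le> e' k" for k
    using d e by (simp add: e'_def)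
  have "eventually (\<lambda>k. e' k = e k) sequentially"
    using eventually_ge_at_top[of k0] by eventually_elim (auto simp: e'_def)
  then have sum_e': "summable e'"
    using \<open>summable e\<close> summable_cong by blast
  have rec': "d k \<le> e' k + c * (\<Sum>j\<in>window m k. d j)" for k
    using rec[of k] d c by (simp add: e'_def sum_nonneg)
  fix n
  have "(\<Sum>k<n. d k) \<le> (\<Sum>k<n. e' k) + c * (\<Sum>k<n. \<Sum>j\<in>window m k. d j)"
    using sum_mono[of "{..<n}", OF rec'] by (simp add: sum.distrib sum_distrib_left)
  also have "\<dots> \<le> suminf e' + c * ((real m + 1) * (\<Sum>j<n. d j))"
    by (intro add_mono mult_left_mono sum_window_sum_le sum_le_suminf sum_e' c d)
      (auto simp: e')
  finally show "(\<Sum>k<n. d k) \<le> suminf e' / (1 - c * (real m + 1))"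
    using c by (simp add: field_simps)
qed (rule d)

section \<open>The KL inequality, made uniform near the cluster points\<close>

text \<open>Concavity puts the graph below its tangent at \<open>s\<close>. The point of tangency is
  positive, where differentiability is assumed, while \<open>t\<close> may be the endpoint
  0.\<close>

lemma desingularizing_tangent:
  assumes "desingularizing \<eta> \<phi>" "0 < s" "ereal s < \<eta>" "0 \<le> t" "t \<le> s"
  shows "deriv \<phi> s * (s - t) \<le> \<phi> s - \<phi> t" "0 < deriv \<phi> s"
proof -
  let ?I = "{t. 0 \<le> t \<and> ereal t < \<eta>}"
  have 1: "concave_on ?I \<phi>" "0 < deriv \<phi> s" "\<phi> differentiable (at s)"
    using assms by (auto simp: desingularizing_def)
  have D: "((\<lambda>t. - \<phi> t) has_real_derivative - deriv \<phi> s) (at s)"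
    using 1(3) DERIV_deriv_iff_real_differentiable by (intro DERIV_minus) blast
  have conn: "connected ?I"
    unfolding connected_iff_interval
  proof (intro ballI allI impI)
    fix p q r assume pqr: "p \<in> ?I" "q \<in> ?I" "p \<le> r" "r \<le> q"
    then have "ereal r \<le> ereal q" by simp
    with pqr show "r \<in> ?I" using le_less_trans[of "ereal r" "ereal q" \<eta>] by auto
  qed
  have int: "s \<in> interior ?I"
  proof (rule interiorI)
    show "open {t. 0 < t \<and> ereal t < \<eta>}"
      by (intro open_Collect_conj open_Collect_less continuous_intros)
  qed (use assms in auto)
  have "t \<in> ?I"
    using assms by (auto intro: le_less_trans[of _ "ereal s"])
  from convex_on_imp_above_tangent[OF 1(1)[unfolded concave_on_def] conn int this
      has_field_derivative_at_within[OF D]]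
  show "deriv \<phi> s * (s - t) \<le> \<phi> s - \<phi> t"
    by (simp add: algebra_simps)
  show "0 < deriv \<phi> s" by fact
qed

text \<open>A derivative-free KL inequality: \<open>1 \<le> norm v * deriv \<phi> s\<close> is
  multiplied by \<open>s - t\<close>, and the tangent bound turns the derivative into an increment
  of \<open>\<phi>\<close>. This form survives adding other monotone functions to
  \<open>\<phi>\<close>. A real \<open>\<delta>\<close> below the possibly infinite
  \<open>\<eta>\<close> keeps all arguments in the domain of \<open>\<phi>\<close>.\<close>

lemma KL_decrease:
  assumes KL: "KL_property_at h z" and z: "h z = ereal c"
  obtains \<delta> U \<phi> where "0 < (\<delta>::real)" "open U" "z \<in> U" "\<And>s. 0 \<le> s \<Longrightarrow> s < \<delta> \<Longrightarrow> 0 \<le> \<phi> s"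
    "\<And>s t. 0 \<le> t \<Longrightarrow> t \<le> s \<Longrightarrow> s < \<delta> \<Longrightarrow> \<phi> t \<le> \<phi> s"
    "\<And>y v s t. \<lbrakk>y \<in> U; v \<in> limiting_subdiff h y; h y = ereal (c + s); 0 \<le> t; t \<le> s; s < \<delta>\<rbrakk>
      \<Longrightarrow> s - t \<le> norm v * (\<phi> s - \<phi> t)"
proof -
  from KL obtain \<eta> U \<phi> where *: "0 < \<eta>" "z \<in> interior U" "desingularizing \<eta> \<phi>"
    "\<And>x. x \<in> U \<Longrightarrow> h z < h x \<Longrightarrow> h x < h z + \<eta> \<Longrightarrow>
      1 \<le> ereal (deriv \<phi> (real_of_ereal (h x - h z))) * edist0 (limiting_subdiff h x)"
    unfolding KL_property_at_def by blast
  from *(1) obtain \<delta> where \<delta>: "0 < ereal \<delta>" "ereal \<delta> < \<eta>"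
    using ereal_dense3 by blast
  have below: "ereal s < \<eta>" if "s < \<delta>" for s
    using that \<delta>(2) by (meson ereal_less_eq(3) le_less_trans less_imp_le)
  have mono: "\<phi> t \<le> \<phi> s" if "0 \<le> t" "t \<le> s" "s < \<delta>" for s t
  proof (cases "s = 0")
    case False
    then have "deriv \<phi> s * (s - t) \<le> \<phi> s - \<phi> t" "0 < deriv \<phi> s"
      using desingularizing_tangent[OF *(3), of s t] that below[of s] by auto
    moreover from this have "0 \<le> deriv \<phi> s * (s - t)"
      using that by simp
    ultimately show ?thesis by linarith
  qed (use that in auto)
  have dec: "s - t \<le> norm v * (\<phi> s - \<phi> t)"
    if "y \<in> interior U" "v \<in> limiting_subdiff h y" "h y = ereal (c + s)" "0 \<le> t" "t \<le> s" "s < \<delta>"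
    for y v s t
  proof (cases "s = t")
    case False
    then have s: "0 < s" "ereal s < \<eta>" using that below by auto
    note tangent = desingularizing_tangent[OF *(3) s that(4,5)]
    have "h y < h z + \<eta>"
      using s unfolding z that(3) by (cases \<eta>) auto
    moreover have "h z < h y"
      using s by (simp add: z that(3))
    moreover have "y \<in> U"
      using that(1) interior_subset by blast
    ultimately have "1 \<le> ereal (deriv \<phi> s) * edist0 (limiting_subdiff h y)"
      using *(4)[of y] by (simp add: z that(3))
    also have "\<dots> \<le> ereal (deriv \<phi> s) * ereal (norm v)"
      unfolding edist0_def using that(2) tangent(2)
      by (intro ereal_mult_left_mono INF_lower) auto
    finally have "1 \<le> norm v * deriv \<phi> s"
      by (simp add: one_ereal_def mult.commute)
    then have "s - t \<le> norm v * (deriv \<phi> s * (s - t))"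
      using mult_right_mono[of 1 "norm v * deriv \<phi> s" "s - t"] that(5) by (simp add: mult.assoc)
    also have "\<dots> \<le> norm v * (\<phi> s - \<phi> t)"
      by (intro mult_left_mono tangent) auto
    finally show ?thesis .
  qed simp
  have pos: "0 \<le> \<phi> s" if "0 \<le> s" "s < \<delta>" for s
    using *(3) that below unfolding desingularizing_def by auto
  show ?thesis
    by (rule that[of \<delta> "interior U" \<phi>]) (use \<delta>(1) *(2) mono dec pos in auto)
qed

lemma cluster_pointsI:
  fixes x :: "nat \<Rightarrow> 'a::metric_space"
  assumes "\<And>e. 0 < e \<Longrightarrow> frequently (\<lambda>k. dist (x k) z < e) sequentially"
  shows "z \<in> cluster_points x"
proof -
  have ex: "\<exists>k>n. dist (x k) z < inverse (Suc j)" for n j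
    using assms[of "inverse (Suc j)"] by (simp add: frequently_sequentially) (meson Suc_le_lessD)
  have "\<exists>r. \<forall>j. dist (x (r j)) z < inverse (Suc j) \<and> r j < r (Suc j)"
    by (rule dependent_nat_choice) (use ex in blast)+
  then obtain r where r: "\<And>j. dist (x (r j)) z < inverse (Suc j)" "\<And>j. r j < r (Suc j)"
    by blast
  have "(\<lambda>j. dist (x (r j)) z) \<longlonglongrightarrow> 0"
    by (rule tendsto_sandwich[OF _ _ tendsto_const LIMSEQ_inverse_real_of_nat])
      (use r(1) in \<open>auto intro: less_imp_le always_eventually\<close>)
  then have "(x \<circ> r) \<longlonglongrightarrow> z"
    by (subst tendsto_dist_iff) (simp add: o_def)
  with r(2) show ?thesis
    unfolding cluster_points_def using strict_mono_Suc_iff by blast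
qed

text \<open>By compactness, finitely many sets \<open>U z\<close> and balls around other points
  cover the closure of the range. The balls are chosen so that the sequence eventually leaves them,
  hence only the sets \<open>U z\<close> remain.\<close>

lemma cluster_points_finite_cover:
  fixes x :: "nat \<Rightarrow> 'a::heine_borel"
  assumes bdd: "bounded (range x)"
    and U: "\<And>z. z \<in> cluster_points x \<Longrightarrow> open (U z) \<and> z \<in> U z"
  obtains F where "finite F" "F \<subseteq> cluster_points x"
    "eventually (\<lambda>k. \<exists>z\<in>F. x k \<in> U z) sequentially"
proof -
  have "\<exists>e>0. eventually (\<lambda>k. x k \<notin> ball z e) sequentially" if "z \<notin> cluster_points x" for z
    using cluster_pointsI[of x z] that
    by (auto simp: frequently_def dist_commute)
  then obtain e where e: "\<And>z. z \<notin> cluster_points x \<Longrightarrow> 0 < e z"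
    "\<And>z. z \<notin> cluster_points x \<Longrightarrow> eventually (\<lambda>k. x k \<notin> ball z (e z)) sequentially"
    by metis
  define V where "V z = (if z \<in> cluster_points x then U z else ball z (e z))" for z
  have "compact (closure (range x))"
    using bdd by (simp add: compact_closure)
  moreover have "\<And>z. z \<in> closure (range x) \<Longrightarrow> open (V z)"
    using U by (auto simp: V_def)
  moreover have "closure (range x) \<subseteq> (\<Union>z\<in>closure (range x). V z)"
    using U e(1) by (force simp: V_def)
  ultimately obtain D where D: "D \<subseteq> closure (range x)" "finite D"
    "closure (range x) \<subseteq> (\<Union>z\<in>D. V z)"
    by (rule compactE_image)
  have "eventually (\<lambda>k. \<forall>z\<in>D - cluster_points x. x k \<notin> ball z (e z)) sequentially"
    using D(2) e(2) by (intro eventually_ball_finite) auto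
  then have "eventually (\<lambda>k. \<exists>z\<in>D \<inter> cluster_points x. x k \<in> U z) sequentially"
  proof eventually_elim
    case (elim k)
    have "x k \<in> closure (range x)"
      using closure_subset[of "range x"] by auto
    then obtain z where z: "z \<in> D" "x k \<in> V z"
      using D(3) by auto
    show ?case
    proof (cases "z \<in> cluster_points x")
      case True
      with z show ?thesis by (auto simp: V_def)
    next
      case False
      with z elim show ?thesis by (auto simp: V_def)
    qed
  qed
  then show ?thesis
    using that[of "D \<inter> cluster_points x"] D(2) by auto
qed

text \<open>Since \<open>h\<close> has the same value \<open>c\<close> at all cluster points, one
  function serves near all of them: the sum of finitely many local ones, below the smallest
  threshold.\<close>

lemma uniform_KL_decrease:
  fixes x :: "nat \<Rightarrow> 'a::euclidean_space"
  assumes bdd: "bounded (range x)"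
    and KL: "\<And>z. z \<in> cluster_points x \<Longrightarrow> KL_property_at h z \<and> h z = ereal c"
  obtains \<delta> \<phi> where "0 < (\<delta>::real)" "\<And>s. 0 \<le> s \<Longrightarrow> s < \<delta> \<Longrightarrow> 0 \<le> \<phi> s"
    "\<And>s t. 0 \<le> t \<Longrightarrow> t \<le> s \<Longrightarrow> s < \<delta> \<Longrightarrow> \<phi> t \<le> \<phi> s"
    "eventually (\<lambda>k. \<forall>v s t. v \<in> limiting_subdiff h (x k) \<longrightarrow> h (x k) = ereal (c + s) \<longrightarrow>
       0 \<le> t \<longrightarrow> t \<le> s \<longrightarrow> s < \<delta> \<longrightarrow> s - t \<le> norm v * (\<phi> s - \<phi> t)) sequentially"
proof -
  define P where "P z \<delta> U \<phi> \<longleftrightarrow> 0 < (\<delta>::real) \<and> open U \<and> z \<in> U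
    \<and> (\<forall>s. 0 \<le> s \<longrightarrow> s < \<delta> \<longrightarrow> 0 \<le> \<phi> s)
    \<and> (\<forall>s t. 0 \<le> t \<longrightarrow> t \<le> s \<longrightarrow> s < \<delta> \<longrightarrow> \<phi> t \<le> \<phi> s)
    \<and> (\<forall>y v s t. y \<in> U \<longrightarrow> v \<in> limiting_subdiff h y \<longrightarrow> h y = ereal (c + s) \<longrightarrow>
        0 \<le> t \<longrightarrow> t \<le> s \<longrightarrow> s < \<delta> \<longrightarrow> s - t \<le> norm v * (\<phi> s - \<phi> t))" for z \<delta> U \<phi>
  have "\<exists>\<delta> U \<phi>. P z \<delta> U \<phi>" if "z \<in> cluster_points x" for z
  proof -
    from KL[OF that] have "KL_property_at h z" "h z = ereal c" by auto
    then show ?thesis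
      by (rule KL_decrease) (unfold P_def, blast)
  qed
  then obtain \<delta> U \<phi> where P: "\<And>z. z \<in> cluster_points x \<Longrightarrow> P z (\<delta> z) (U z) (\<phi> z)"
    by metis
  obtain F where F: "finite F" "F \<subseteq> cluster_points x"
    "eventually (\<lambda>k. \<exists>z\<in>F. x k \<in> U z) sequentially"
    by (rule cluster_points_finite_cover[OF bdd, of U]) (use P in \<open>auto simp: P_def\<close>)
  \<comment> \<open>The extra element \<open>1\<close> keeps \<open>Min\<close> meaningful for an
    empty \<open>F\<close>.\<close>
  define \<delta>0 where "\<delta>0 = Min (insert 1 (\<delta> ` F))"
  have PF: "P z (\<delta> z) (U z) (\<phi> z)" "\<delta>0 \<le> \<delta> z" if "z \<in> F" for z
    using F(1,2) that P by (auto simp: \<delta>0_def)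
  show ?thesis
  proof (rule that[of \<delta>0 "\<lambda>s. \<Sum>z\<in>F. \<phi> z s"])
    show "0 < \<delta>0"
      using F(1) PF(1) by (auto simp: \<delta>0_def P_def)
    show "0 \<le> (\<Sum>z\<in>F. \<phi> z s)" if "0 \<le> s" "s < \<delta>0" for s
      using that PF by (intro sum_nonneg) (force simp: P_def)
    show "(\<Sum>z\<in>F. \<phi> z t) \<le> (\<Sum>z\<in>F. \<phi> z s)" if "0 \<le> t" "t \<le> s" "s < \<delta>0" for s t
      using that PF by (intro sum_mono) (force simp: P_def)
    show "eventually (\<lambda>k. \<forall>v s t. v \<in> limiting_subdiff h (x k) \<longrightarrow> h (x k) = ereal (c + s) \<longrightarrow>
       0 \<le> t \<longrightarrow> t \<le> s \<longrightarrow> s < \<delta>0 \<longrightarrow>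
       s - t \<le> norm v * ((\<Sum>z\<in>F. \<phi> z s) - (\<Sum>z\<in>F. \<phi> z t))) sequentially"
      using F(3)
    proof eventually_elim
      case (elim k)
      then obtain z where z: "z \<in> F" "x k \<in> U z" by blast
      show ?case
      proof (intro allI impI)
        fix v s t
        assume *: "v \<in> limiting_subdiff h (x k)" "h (x k) = ereal (c + s)"
          "0 \<le> t" "t \<le> s" "s < \<delta>0"
        have "s - t \<le> norm v * (\<phi> z s - \<phi> z t)"
          using PF[OF z(1)] z(2) * by (auto simp: P_def)
        \<comment> \<open>By monotonicity the other summands have nonnegative increments, so adding
          them only weakens the bound.\<close>
        also have "\<dots> \<le> norm v * (\<Sum>z\<in>F. \<phi> z s - \<phi> z t)"
        proof (intro mult_left_mono member_le_sum)
          show "0 \<le> \<phi> y s - \<phi> y t" if "y \<in> F - {z}" for y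
            using that PF[of y] * by (force simp: P_def)
        qed (use z F in auto)
        finally show "s - t \<le> norm v * ((\<Sum>z\<in>F. \<phi> z s) - (\<Sum>z\<in>F. \<phi> z t))"
          by (simp add: sum_subtractf)
      qed
    qed
  qed
qed

section \<open>Subgradients of weakly convex functions and closedness of the limiting
  subdifferential\<close>

text \<open>The lower limit is multiplied out by the positive distance. The value
  \<open>- \<infinity>\<close> of \<open>h y\<close> is excluded, as the quotient would be
  \<open>- \<infinity>\<close> too; the value \<open>\<infinity>\<close> is trivial.\<close>

lemma regular_subdiffD:
  fixes h :: "'a::euclidean_space \<Rightarrow> ereal"
  assumes v: "v \<in> regular_subdiff h u" and u: "h u = ereal c" and "0 < e"
  shows "eventually (\<lambda>y. ereal (c + v \<bullet> (y - u) - e * norm (y - u)) \<le> h y) (at u)"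
proof -
  have "ereal (- e) < 0" using \<open>0 < e\<close> by simp
  also have "0 \<le> Liminf (at u) (\<lambda>y. (h y - h u - ereal (v \<bullet> (y - u))) / ereal (norm (y - u)))"
    using v by (simp add: regular_subdiff_def)
  finally have "eventually (\<lambda>y. ereal (- e) < (h y - h u - ereal (v \<bullet> (y - u))) / ereal (norm (y - u))) (at u)"
    by (rule less_LiminfD)
  then show ?thesis
    using eventually_neq_at_within[of u u UNIV]
  proof eventually_elim
    case (elim y)
    then have n: "0 < norm (y - u)" by simp
    show ?case
    proof (cases "h y")
      case (real r)
      with elim(1) n have "- e < (r - c - v \<bullet> (y - u)) / norm (y - u)"
        by (simp add: u)
      then show ?thesis
        using n by (simp add: real field_simps)
    next
      case MInf
      with elim(1) n show ?thesis by (simp add: u ereal_divide_eq)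
    qed simp
  qed
qed

text \<open>The quotient of the regular subdifferential is only evaluated along the segment to \<open>y\<close>.\<close>

lemma weakly_convex_regular_subgradient:
  fixes h :: "'a::euclidean_space \<Rightarrow> ereal"
  assumes wc: "weakly_convex_on \<rho> N h" and B: "convex B" "B \<subseteq> N" "u \<in> B" "y \<in> B"
    and v: "v \<in> regular_subdiff h u" and u: "h u = ereal c" and y: "h y = ereal c'"
  shows "c + v \<bullet> (y - u) - \<rho> / 2 * (norm (y - u))\<^sup>2 \<le> c'"
proof (cases "y = u")
  case False
  define n where "n = norm (y - u)"
  have n: "0 < n" using False by (simp add: n_def)
  have seg: "closed_segment u y \<subseteq> N"
    using B by (meson closed_segment_subset order_trans)
  show ?thesis
  proof (rule field_le_epsilon)
    fix e :: real assume "0 < e"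
    \<comment> \<open>The slope \<open>e / n\<close> is scaled so that at parameter
      \<open>t\<close>, at distance \<open>t * n\<close> from \<open>u\<close>, the error is exactly
      \<open>e * t\<close>.\<close>
    then have "eventually (\<lambda>q. ereal (c + v \<bullet> (q - u) - (e / n) * norm (q - u)) \<le> h q) (at u)"
      using n by (intro regular_subdiffD[OF v u]) auto
    moreover have "filterlim (\<lambda>t. (1 - t) *\<^sub>R u + t *\<^sub>R y) (at u) (at_right 0)"
    proof -
      have "((\<lambda>t. (1 - t) *\<^sub>R u + t *\<^sub>R y) \<longlongrightarrow> (1 - 0) *\<^sub>R u + 0 *\<^sub>R y) (at_right 0)"
        by (intro tendsto_intros)
      moreover have "eventually (\<lambda>t. (1 - t) *\<^sub>R u + t *\<^sub>R y \<noteq> u) (at_right (0::real))"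
      proof -
        have "t *\<^sub>R (y - u) \<noteq> 0" if "0 < t" for t :: real
          using that False by simp
        then show ?thesis
          by (intro eventually_at_right_less[THEN eventually_mono]) (auto simp: algebra_simps)
      qed
      ultimately show ?thesis
        by (simp add: filterlim_at)
    qed
    ultimately have "eventually (\<lambda>t. ereal (c + v \<bullet> (((1 - t) *\<^sub>R u + t *\<^sub>R y) - u)
        - (e / n) * norm (((1 - t) *\<^sub>R u + t *\<^sub>R y) - u)) \<le> h ((1 - t) *\<^sub>R u + t *\<^sub>R y)) (at_right 0)"
      by (rule eventually_compose_filterlim)
    moreover have "eventually (\<lambda>t. t \<in> {0<..<1}) (at_right (0::real))"
      by (rule eventually_at_right_real) simp
    \<comment> \<open>The first-order bound and the convexity inequality combine to a multiple of
      \<open>t\<close>; once \<open>t\<close> is cancelled, it survives only in the factor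
      \<open>1 - t\<close>, which tends to 1.\<close>
    ultimately have ev: "eventually (\<lambda>t. c + v \<bullet> (y - u) - e
        - \<rho> / 2 * (1 - t) * n\<^sup>2 \<le> c') (at_right 0)"
    proof eventually_elim
      case (elim t)
      define q where "q = (1 - t) *\<^sub>R u + t *\<^sub>R y"
      have qu: "q - u = t *\<^sub>R (y - u)"
        by (simp add: q_def algebra_simps)
      have A: "ereal (c + v \<bullet> (q - u) - (e / n) * norm (q - u)) \<le> h q"
        using elim(1) by (simp add: q_def)
      then have A': "ereal (c + t * (v \<bullet> (y - u)) - e * t) \<le> h q"
        using elim(2) n by (simp add: qu n_def[symmetric])
      have "h q + ereal (\<rho> / 2 * (norm q)\<^sup>2) \<le> ereal (1 - t) * (h u + ereal (\<rho> / 2 * (norm u)\<^sup>2))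
          + ereal t * (h y + ereal (\<rho> / 2 * (norm y)\<^sup>2))"
        using wc seg elim(2) unfolding weakly_convex_on_def q_def Let_def by auto
      then have "h q + ereal (\<rho> / 2 * (norm q)\<^sup>2) \<le> ereal ((1 - t) * (c + \<rho> / 2 * (norm u)\<^sup>2)
          + t * (c' + \<rho> / 2 * (norm y)\<^sup>2))"
        by (simp add: u y)
      with A' have "c + t * (v \<bullet> (y - u)) - e * t + \<rho> / 2 * (norm q)\<^sup>2 \<le> (1 - t) * (c + \<rho> / 2 * (norm u)\<^sup>2)
          + t * (c' + \<rho> / 2 * (norm y)\<^sup>2)"
        by (cases "h q") auto
      \<comment> \<open>The weighted squared norms cancel against those from weak convexity, leaving
        only the correction in \<open>n\<close>.\<close>
      moreover have "(norm q)\<^sup>2 = (1 - t) * (norm u)\<^sup>2 + t * (norm y)\<^sup>2 - t * (1 - t) * n\<^sup>2"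
        unfolding n_def q_def power2_norm_eq_inner
        by (simp add: inner_simps inner_commute algebra_simps power2_eq_square)
      ultimately have "c + t * (v \<bullet> (y - u)) - e * t
          + \<rho> / 2 * ((1 - t) * (norm u)\<^sup>2 + t * (norm y)\<^sup>2 - t * (1 - t) * n\<^sup>2)
          \<le> (1 - t) * (c + \<rho> / 2 * (norm u)\<^sup>2) + t * (c' + \<rho> / 2 * (norm y)\<^sup>2)"
        by metis
      also have "c + t * (v \<bullet> (y - u)) - e * t
          + \<rho> / 2 * ((1 - t) * (norm u)\<^sup>2 + t * (norm y)\<^sup>2 - t * (1 - t) * n\<^sup>2) =
          t * (c + v \<bullet> (y - u) - e - \<rho> / 2 * (1 - t) * n\<^sup>2)
          + ((1 - t) * (c + \<rho> / 2 * (norm u)\<^sup>2) + t * (\<rho> / 2 * (norm y)\<^sup>2))"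
        by (simp add: field_simps)
      finally have "t * (c + v \<bullet> (y - u) - e - \<rho> / 2 * (1 - t) * n\<^sup>2) \<le> t * c'"
        by (simp add: distrib_left)
      then show ?case
        using elim(2) by simp
    qed
    have "((\<lambda>t. c + v \<bullet> (y - u) - e - \<rho> / 2 * (1 - t) * n\<^sup>2)
        \<longlongrightarrow> c + v \<bullet> (y - u) - e - \<rho> / 2 * (1 - 0) * n\<^sup>2) (at_right 0)"
      by (intro tendsto_intros)
    then have "c + v \<bullet> (y - u) - e - \<rho> / 2 * (1 - 0) * n\<^sup>2 \<le> c'"
      using ev by (rule tendsto_upperbound) simp
    then show "c + v \<bullet> (y - u) - \<rho> / 2 * (norm (y - u))\<^sup>2 \<le> c' + e"
      by (simp add: n_def)
  qed
qed (use u y in auto)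

text \<open>Limit of the regular case along the sequences defining \<open>v\<close>. Openness puts
  the base points eventually into \<open>B\<close>, convexity keeps the segments to \<open>y\<close>
  inside \<open>N\<close>, and convergence of the values is part of the definition of the
  subdifferential.\<close>

lemma weakly_convex_limiting_subgradient:
  fixes h :: "'a::euclidean_space \<Rightarrow> ereal"
  assumes wc: "weakly_convex_on \<rho> N h" and B: "convex B" "open B" "B \<subseteq> N" "u \<in> B" "y \<in> B"
    and v: "v \<in> limiting_subdiff h u" and u: "h u = ereal c" and y: "h y = ereal c'"
  shows "c + v \<bullet> (y - u) - \<rho> / 2 * (norm (y - u))\<^sup>2 \<le> c'"
proof -
  from v obtain p w where p: "p \<longlonglongrightarrow> u" and hp: "(\<lambda>n. h (p n)) \<longlonglongrightarrow> ereal c"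
    and reg: "\<And>n. w n \<in> regular_subdiff h (p n)" and w: "w \<longlonglongrightarrow> v"
    unfolding limiting_subdiff_def u by blast
  have lim: "(\<lambda>n. real_of_ereal (h (p n)) + w n \<bullet> (y - p n) - \<rho> / 2 * (norm (y - p n))\<^sup>2)
      \<longlonglongrightarrow> c + v \<bullet> (y - u) - \<rho> / 2 * (norm (y - u))\<^sup>2"
    by (intro tendsto_intros p w lim_real_of_ereal hp)
  have "eventually (\<lambda>n. - \<infinity> < h (p n)) sequentially" "eventually (\<lambda>n. h (p n) < \<infinity>) sequentially"
    using order_tendstoD[OF hp, of "- \<infinity>"] order_tendstoD[OF hp, of "\<infinity>"] by simp_all
  moreover have "eventually (\<lambda>n. p n \<in> B) sequentially"
    using p B by (simp add: topological_tendstoD)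
  ultimately have "eventually (\<lambda>n. real_of_ereal (h (p n)) + w n \<bullet> (y - p n)
      - \<rho> / 2 * (norm (y - p n))\<^sup>2 \<le> c') sequentially"
  proof eventually_elim
    case (elim n)
    then have "h (p n) = ereal (real_of_ereal (h (p n)))"
      by (cases "h (p n)") auto
    from weakly_convex_regular_subgradient[OF wc B(1,3) elim(3) B(5) reg this y]
    show ?case .
  qed
  then show ?thesis
    by (rule tendsto_upperbound[OF lim]) auto
qed

text \<open>Diagonal argument: for each \<open>n\<close>, pick a regular subgradient so that point,
  value and subgradient lie within \<open>e n\<close> of \<open>q n\<close>, \<open>f n\<close> and
  \<open>w n\<close>.\<close>

lemma limiting_subdiff_closed:
  fixes h :: "'a::euclidean_space \<Rightarrow> ereal"
  assumes q: "q \<longlonglongrightarrow> z" and hq: "\<And>n. h (q n) = ereal (f n)" and f: "f \<longlonglongrightarrow> c" and z: "h z = ereal c"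
    and w: "\<And>n. w n \<in> limiting_subdiff h (q n)" "w \<longlonglongrightarrow> v"
  shows "v \<in> limiting_subdiff h z"
proof -
  define e where "e n = inverse (real (Suc n))" for n
  have e: "0 < e n" "e \<longlonglongrightarrow> 0" for n
    using LIMSEQ_inverse_real_of_nat by (auto simp: e_def[abs_def])
  have "\<exists>p w'. dist p (q n) < e n \<and> ereal (f n - e n) < h p \<and> h p < ereal (f n + e n)
      \<and> w' \<in> regular_subdiff h p \<and> dist w' (w n) < e n" for n
  proof -
    from w(1)[of n] obtain p u where p: "p \<longlonglongrightarrow> q n" and hp: "(\<lambda>n. h (p n)) \<longlonglongrightarrow> ereal (f n)"
      and reg: "\<And>n. u n \<in> regular_subdiff h (p n)" and u: "u \<longlonglongrightarrow> w n"
      unfolding limiting_subdiff_def hq by blast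
    have "eventually (\<lambda>i. dist (p i) (q n) < e n) sequentially"
      "eventually (\<lambda>i. dist (u i) (w n) < e n) sequentially"
      using p u e(1)[of n] by (auto simp: tendsto_iff)
    moreover have "eventually (\<lambda>i. ereal (f n - e n) < h (p i)) sequentially"
      "eventually (\<lambda>i. h (p i) < ereal (f n + e n)) sequentially"
      using hp e(1)[of n] by (auto simp: order_tendsto_iff)
    ultimately have "eventually (\<lambda>i. dist (p i) (q n) < e n \<and> ereal (f n - e n) < h (p i)
        \<and> h (p i) < ereal (f n + e n) \<and> dist (u i) (w n) < e n) sequentially"
      by eventually_elim blast
    then show ?thesis
      using reg by (auto dest!: eventually_happens'[OF sequentially_bot])
  qed
  then obtain p w' where *: "\<And>n. dist (p n) (q n) < e n" "\<And>n. ereal (f n - e n) < h (p n)"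
    "\<And>n. h (p n) < ereal (f n + e n)" "\<And>n. w' n \<in> regular_subdiff h (p n)"
    "\<And>n. dist (w' n) (w n) < e n"
    by metis
  have close: "s \<longlonglongrightarrow> l" if "t \<longlonglongrightarrow> l" "\<And>n. dist (s n) (t n) < e n" for s t :: "nat \<Rightarrow> 'a" and l
  proof -
    have "(\<lambda>n. dist (s n) (t n)) \<longlonglongrightarrow> 0"
      by (rule tendsto_sandwich[OF _ _ tendsto_const e(2)])
        (use that(2) in \<open>auto intro: less_imp_le always_eventually\<close>)
    then have "(\<lambda>n. s n - t n) \<longlonglongrightarrow> 0"
      by (simp add: dist_norm tendsto_norm_zero_iff)
    from tendsto_add[OF this that(1)] show ?thesis
      by simp
  qed
  have "(\<lambda>n. h (p n)) \<longlonglongrightarrow> ereal c"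
  proof (rule tendsto_sandwich)
    show "(\<lambda>n. ereal (f n - e n)) \<longlonglongrightarrow> ereal c" "(\<lambda>n. ereal (f n + e n)) \<longlonglongrightarrow> ereal c"
      using tendsto_diff[OF f e(2)] tendsto_add[OF f e(2)] by auto
  qed (use *(2,3) in \<open>auto intro: less_imp_le always_eventually\<close>)
  then show ?thesis
    unfolding limiting_subdiff_def edom_def using z *(4) close[OF q *(1)] close[OF w(2) *(5)]
    by auto
qed

lemma lsc_le_of_tendsto:
  assumes "lsc h" "q \<longlonglongrightarrow> z" "(\<lambda>n. h (q n)) \<longlonglongrightarrow> l"
  shows "h z \<le> l"
proof (rule ccontr)
  assume "\<not> h z \<le> l"
  then obtain c where c: "l < c" "c < h z"
    by (meson dense not_le)
  have "c < Liminf (at z) h"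
    using c(2) \<open>lsc h\<close> unfolding lsc_def by (meson less_le_trans)
  then have "eventually (\<lambda>y. c < h y) (at z)"
    by (rule less_LiminfD)
  \<comment> \<open>\<open>lsc\<close> controls only punctured neighbourhoods, while the sequence
    may hit \<open>z\<close> itself; there \<open>c < h z\<close> supplies the bound.\<close>
  then have "eventually (\<lambda>y. c < h y) (nhds z)"
    using c(2) by (metis (mono_tags, lifting) eventually_nhds_conv_at)
  then have "eventually (\<lambda>n. c < h (q n)) sequentially"
    using \<open>q \<longlonglongrightarrow> z\<close> by (rule eventually_compose_filterlim)
  moreover have "eventually (\<lambda>n. h (q n) < c) sequentially"
    using assms(3) c(1) by (simp add: order_tendsto_iff)
  ultimately have "eventually (\<lambda>n. False) sequentially"
    by eventually_elim auto
  then show False by simp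
qed

section \<open>The descent sequence, its limits and its cluster points\<close>

text \<open>Subgradients exist at all iterates, so the values are finite and are recorded as reals
  \<open>f k\<close>. Weak convexity enters later, as a premise of
  \<open>summable_sqrt_gap\<close>.\<close>

locale nonmonotone_descent =
  fixes \<Phi> :: "'a::euclidean_space \<Rightarrow> ereal"
    and m :: nat and a b :: real and x w :: "nat \<Rightarrow> 'a" and f :: "nat \<Rightarrow> real"
  assumes val: "\<Phi> (x k) = ereal (f k)"
    and lsc: "lsc \<Phi>" and coercive: "coercive \<Phi>" and below: "bounded_from_below \<Phi>"
    and KL: "KL_function \<Phi>"
    and a_pos: "a > 0" and b_pos: "b > 0"
    and decrease: "f (Suc k) + a * (norm (x (Suc k) - x k))\<^sup>2 \<le> Max (f ` window m k)"
    and w_subdiff: "w k \<in> limiting_subdiff \<Phi> (x k)"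
    and w_le: "norm (w (Suc k)) \<le> b * norm (x (Suc k) - x k)"
    and liminf_ge: "lim (\<lambda>k. \<Phi> (x (ell \<Phi> m x k))) \<le> liminf (\<lambda>k. \<Phi> (x k))"
    and limsup_le: "strict_mono r \<Longrightarrow> (x \<circ> r) \<longlonglongrightarrow> z \<Longrightarrow> limsup (\<lambda>j. \<Phi> (x (r j))) \<le> \<Phi> z"
begin

definition d :: "nat \<Rightarrow> real" where "d k = norm (x (Suc k) - x k)"
definition L :: "nat \<Rightarrow> real" where "L k = Max (f ` window m k)"
text \<open>Turns out to be the limit of \<open>f\<close> as well, and the value of
  \<open>\<Phi>\<close> at every cluster point.\<close>

definition \<Lambda> :: real where "\<Lambda> = lim L"

lemma d_nonneg [simp]: "0 \<le> d k"
  by (simp add: d_def)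

lemma finite_window [simp]: "finite (window m k)"
  by (simp add: window_def)

lemma self_in_window [simp]: "k \<in> window m k"
  by (simp add: window_def)

lemma le_L: "j \<in> window m k \<Longrightarrow> f j \<le> L k"
  by (simp add: L_def)

lemma ell_window: "ell \<Phi> m x k \<in> window m k" and f_ell: "f (ell \<Phi> m x k) = L k"
proof -
  let ?S = "{j \<in> window m k. \<forall>i\<in>window m k. \<Phi> (x i) \<le> \<Phi> (x j)}"
  have "Max (f ` window m k) \<in> f ` window m k"
    using self_in_window by (intro Max_in) (auto simp del: self_in_window)
  then obtain j where "j \<in> window m k" "f j = L k"
    by (auto simp: L_def)
  then have "j \<in> ?S"
    by (auto simp: val le_L)
  then have "Max ?S \<in> ?S"
    by (intro Max_in) auto
  then have *: "ell \<Phi> m x k \<in> ?S"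
    by (simp add: ell_def)
  then show "ell \<Phi> m x k \<in> window m k" by simp
  then have "f (ell \<Phi> m x k) \<le> L k" by (rule le_L)
  moreover have "f j \<le> f (ell \<Phi> m x k)"
    using * \<open>j \<in> ?S\<close> by (auto simp: val)
  ultimately show "f (ell \<Phi> m x k) = L k"
    using \<open>f j = L k\<close> by simp
qed

lemma L_decrease: "f (Suc k) + a * (d k)\<^sup>2 \<le> L k"
  using decrease by (simp add: d_def L_def)

lemma L_Suc_le: "L (Suc k) \<le> L k"
proof -
  have "f (Suc k) \<le> L k"
    using L_decrease[of k] a_pos by (smt (verit) mult_nonneg_nonneg zero_le_power2)
  \<comment> \<open>Moving the window forward adds only the index \<open>Suc k\<close>, whose value
    the descent inequality bounds.\<close>
  moreover have "j = Suc k \<or> j \<in> window m k" if "j \<in> window m (Suc k)" for j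
    using that by (auto simp: window_def)
  ultimately have "f j \<le> L k" if "j \<in> window m (Suc k)" for j
    using that le_L by blast
  then show ?thesis
    using ell_window[of "Suc k"] f_ell[of "Suc k"] by metis
qed

lemma L_tendsto: "L \<longlonglongrightarrow> \<Lambda>" and L_ge: "\<Lambda> \<le> L k"
proof -
  obtain c where c: "\<And>x. ereal c \<le> \<Phi> x"
    using below unfolding bounded_from_below_def by blast
  have "c \<le> L k" for k
    using c[of "x k"] le_L[of k k] by (simp add: val)
  moreover have "decseq L"
    using L_Suc_le by (rule decseq_SucI)
  ultimately obtain l where l: "L \<longlonglongrightarrow> l" "\<And>i. l \<le> L i"
    by (metis decseq_convergent)
  then show "L \<longlonglongrightarrow> \<Lambda>" "\<Lambda> \<le> L k"
    unfolding \<Lambda>_def by (simp_all add: limI)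
qed

text \<open>The upper bound comes from \<open>f k \<le> L k\<close>, the lower one from
  \<open>liminf_ge\<close> rewritten by \<open>f_ell\<close>.\<close>

lemma f_tendsto: "f \<longlonglongrightarrow> \<Lambda>"
proof (rule limsup_le_liminf_real)
  have L_lim: "(\<lambda>k. ereal (L k)) \<longlonglongrightarrow> ereal \<Lambda>"
    using L_tendsto by simp
  then show "ereal \<Lambda> \<le> liminf (\<lambda>k. ereal (f k))"
    using liminf_ge limI[OF L_lim] by (simp add: val f_ell)
  have "limsup (\<lambda>k. ereal (f k)) \<le> limsup (\<lambda>k. ereal (L k))"
    by (intro Limsup_mono always_eventually allI) (simp add: le_L)
  also have "\<dots> = ereal \<Lambda>"
    using L_lim by (simp add: lim_imp_Limsup)
  finally show "limsup (\<lambda>k. ereal (f k)) \<le> ereal \<Lambda>" .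
qed

text \<open>Descent bounds \<open>a * (d k)\<^sup>2\<close> by \<open>L k - f (Suc k)\<close>, and
  both terms tend to \<open>\<Lambda>\<close>.\<close>

lemma d_tendsto: "d \<longlonglongrightarrow> 0"
proof -
  have "(\<lambda>k. (L k - f (Suc k)) / a) \<longlonglongrightarrow> (\<Lambda> - \<Lambda>) / a"
    using a_pos by (intro tendsto_intros L_tendsto LIMSEQ_Suc f_tendsto) auto
  then have lim: "(\<lambda>k. (L k - f (Suc k)) / a) \<longlonglongrightarrow> 0" by simp
  have "norm ((d k)\<^sup>2) \<le> (L k - f (Suc k)) / a" for k
    using L_decrease[of k] a_pos by (simp add: field_simps)
  then have "(\<lambda>k. (d k)\<^sup>2) \<longlonglongrightarrow> 0"
    by (intro Lim_null_comparison[OF _ lim] always_eventually allI)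
  then have "(\<lambda>k. sqrt ((d k)\<^sup>2)) \<longlonglongrightarrow> sqrt 0"
    by (rule tendsto_real_sqrt)
  then show ?thesis by simp
qed

text \<open>All values stay below \<open>L 0\<close>, and coercivity bounds that sublevel
  set.\<close>

lemma bounded_iterates: "bounded (range x)"
proof -
  have "eventually (\<lambda>y. ereal (L 0) < \<Phi> y) at_infinity"
    using coercive unfolding coercive_def by (rule order_tendstoD) simp
  then obtain B where B: "\<And>y. B \<le> norm y \<Longrightarrow> ereal (L 0) < \<Phi> y"
    unfolding eventually_at_infinity by blast
  have f_le: "f k \<le> L 0" for k
    using le_L[of k k] decseqD[OF decseq_SucI[of L, OF L_Suc_le], of 0 k] by simp
  have "norm (x k) \<le> B" for k
    using B[of "x k"] f_le[of k] by (cases "B \<le> norm (x k)") (simp_all add: val)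
  then show ?thesis
    by (auto simp: bounded_iff)
qed

text \<open>Lower semicontinuity bounds \<open>\<Phi> z\<close> from above and
  \<open>limsup_le\<close> from below. The steps vanish, hence so do the subgradients; by closedness
  \<open>0\<close> is a limiting subgradient at \<open>z\<close>, so the KL assumption covers
  \<open>z\<close>.\<close>

lemma cluster_point_value:
  assumes "z \<in> cluster_points x"
  shows "\<Phi> z = ereal \<Lambda>" and "KL_property_at \<Phi> z"
proof -
  from assms obtain r where r: "strict_mono r" "(x \<circ> r) \<longlonglongrightarrow> z"
    unfolding cluster_points_def by blast
  have fr: "(\<lambda>j. f (r j)) \<longlonglongrightarrow> \<Lambda>"
    using LIMSEQ_subseq_LIMSEQ[OF f_tendsto r(1)] by (simp add: o_def)
  then have fr': "(\<lambda>j. \<Phi> (x (r j))) \<longlonglongrightarrow> ereal \<Lambda>"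
    by (simp add: val)
  have "\<Phi> z \<le> ereal \<Lambda>"
    using lsc_le_of_tendsto[OF lsc r(2)] fr' by (simp add: o_def)
  moreover have "ereal \<Lambda> \<le> \<Phi> z"
    using limsup_le[OF r] lim_imp_Limsup[OF _ fr'] by simp
  ultimately show z: "\<Phi> z = ereal \<Lambda>" by (rule antisym)
  have "(\<lambda>k. norm (w (Suc k))) \<longlonglongrightarrow> 0"
  proof (rule tendsto_sandwich[OF _ _ tendsto_const])
    show "(\<lambda>k. b * d k) \<longlonglongrightarrow> 0"
      using tendsto_mult_right_zero[OF d_tendsto] by simp
  qed (use w_le in \<open>auto simp: d_def\<close>)
  then have "w \<longlonglongrightarrow> 0"
    by (simp add: tendsto_norm_zero_iff filterlim_sequentially_Suc)
  then have "0 \<in> limiting_subdiff \<Phi> z"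
    using limiting_subdiff_closed[of "x \<circ> r" z \<Phi> "\<lambda>j. f (r j)" \<Lambda> "w \<circ> r" 0]
      r fr z w_subdiff val LIMSEQ_subseq_LIMSEQ[of w 0 r] by simp
  then show "KL_property_at \<Phi> z"
    using KL unfolding KL_function_def dom_subdiff_def by blast
qed

section \<open>Summability from quadratic decrease through the KL inequality\<close>

text \<open>Common core of both sufficiency arguments: a step is either dominated by a summable term
  or paid for by a quadratic decrease of \<open>L\<close>, and the alternative may vary with
  \<open>k\<close>.\<close>

lemma summable_steps:
  assumes c: "0 < c" and e: "\<And>k. 0 \<le> e k" "summable e"
    and step: "eventually (\<lambda>k. d k \<le> e k \<or> c * (d k)\<^sup>2 \<le> L k - L (Suc k)) sequentially"
  shows "summable d"
proof -
  obtain \<delta> \<phi> where \<delta>: "0 < (\<delta>::real)" and \<phi>_nonneg: "\<And>s. 0 \<le> s \<Longrightarrow> s < \<delta> \<Longrightarrow> 0 \<le> \<phi> s"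
    and \<phi>_mono: "\<And>s t. 0 \<le> t \<Longrightarrow> t \<le> s \<Longrightarrow> s < \<delta> \<Longrightarrow> \<phi> t \<le> \<phi> s"
    and \<phi>_KL: "eventually (\<lambda>k. \<forall>v s t. v \<in> limiting_subdiff \<Phi> (x k) \<longrightarrow> \<Phi> (x k) = ereal (\<Lambda> + s) \<longrightarrow>
       0 \<le> t \<longrightarrow> t \<le> s \<longrightarrow> s < \<delta> \<longrightarrow> s - t \<le> norm v * (\<phi> s - \<phi> t)) sequentially"
    using uniform_KL_decrease[OF bounded_iterates, of \<Phi> \<Lambda>] cluster_point_value by blast
  define p where "p k = \<phi> (L k - \<Lambda>)" for k
  \<comment> \<open>The step ending at the iterate realizing \<open>L k\<close> can have an index as
    small as \<open>k - m - 1\<close>, hence windows with \<open>m + 1\<close>.\<close>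
  define W where "W k = (\<Sum>j\<in>window (m + 1) k. d j)" for k
  \<comment> \<open>Windows have at most \<open>m + 2\<close> elements, so the recursion factor
    \<open>\<epsilon> * (m + 2)\<close> is 1/2. The constant \<open>C\<close> satisfies
    \<open>4 * C * \<epsilon> = b / c\<close>, as AM-GM requires below.\<close>
  define \<epsilon> where "\<epsilon> = 1 / (2 * (real m + 2))"
  define C where "C = b / (4 * c * \<epsilon>)"
  have pos: "0 < \<epsilon>" "0 < C"
    using c b_pos by (auto simp: \<epsilon>_def C_def)
  \<comment> \<open>Needed to apply the eventual KL inequality at the maximizing iterates.\<close>
  have "filterlim (ell \<Phi> m x) at_top sequentially"
  proof (rule filterlim_at_top_mono[OF filterlim_minus_const_nat_at_top])
    show "eventually (\<lambda>k. k - m \<le> ell \<Phi> m x k) sequentially"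
      using ell_window by (intro always_eventually) (auto simp: window_def)
  qed
  note KL_ell = eventually_compose_filterlim[OF \<phi>_KL this]
  have "eventually (\<lambda>k. L k < \<Lambda> + \<delta>) sequentially"
    using L_tendsto \<delta> by (simp add: order_tendstoD(2))
  then have "eventually (\<lambda>k. L k - \<Lambda> < \<delta> \<and> (d k \<le> e k \<or>
      c * (d k)\<^sup>2 \<le> b * W k * (p k - p (Suc k)))) sequentially"
    using step KL_ell eventually_ge_at_top[of "Suc m"]
  proof eventually_elim
    case (elim k)
    let ?l = "ell \<Phi> m x k"
    have l: "k - m \<le> ?l" "?l \<le> k"
      using ell_window[of k] by (auto simp: window_def)
    \<comment> \<open>Here \<open>k > m\<close> makes \<open>?l\<close> positive, so the subtraction
      is not truncated.\<close>
    have "Suc (?l - 1) = ?l" "?l - 1 \<in> window (m + 1) k"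
      using l elim(4) by (auto simp: window_def)
    then have "norm (w ?l) \<le> b * d (?l - 1)"
      using w_le[of "?l - 1"] by (simp add: d_def)
    also have "\<dots> \<le> b * W k"
      unfolding W_def using b_pos \<open>?l - 1 \<in> _\<close>
      by (intro mult_left_mono member_le_sum) (auto simp: window_def)
    finally have wl: "norm (w ?l) \<le> b * W k" .
    \<comment> \<open>KL at \<open>x ?l\<close>, whose value is exactly \<open>L k\<close>, with
      \<open>s = L k - \<Lambda>\<close> and \<open>t = L (Suc k) - \<Lambda>\<close>.\<close>
    have "L k - \<Lambda> - (L (Suc k) - \<Lambda>) \<le> norm (w ?l) * (p k - p (Suc k))"
      unfolding p_def
      by (rule elim(3)[rule_format])
        (use w_subdiff L_ge L_Suc_le elim(1) in \<open>auto simp: val f_ell\<close>)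
    also have "\<dots> \<le> b * W k * (p k - p (Suc k))"
      using wl \<phi>_mono[of "L (Suc k) - \<Lambda>" "L k - \<Lambda>"] L_ge[of "Suc k"] L_Suc_le[of k] elim(1)
      by (intro mult_right_mono) (auto simp: p_def)
    finally show ?case
      using elim(1,2) by auto
  qed
  then obtain k0 where k0: "\<And>k. k \<ge> k0 \<Longrightarrow> L k - \<Lambda> < \<delta>"
    "\<And>k. k \<ge> k0 \<Longrightarrow> d k \<le> e k \<or> c * (d k)\<^sup>2 \<le> b * W k * (p k - p (Suc k))"
    unfolding eventually_sequentially by blast
  have p_dec: "p (Suc k) \<le> p k" "0 \<le> p k" if "k \<ge> k0" for k
    using \<phi>_mono[of "L (Suc k) - \<Lambda>" "L k - \<Lambda>"] \<phi>_nonneg[of "L k - \<Lambda>"]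
      L_ge[of "Suc k"] L_ge[of k] L_Suc_le[of k] k0(1)[OF that] by (auto simp: p_def)
  \<comment> \<open>Monotonicity of \<open>p\<close> is known only from \<open>k0\<close> on, hence
    the shift; convergence then makes its differences summable.\<close>
  have "decseq (\<lambda>k. p (k + k0))"
    by (rule decseq_SucI) (simp add: p_dec)
  then obtain q where "(\<lambda>k. p (k + k0)) \<longlonglongrightarrow> q"
    by (rule decseq_convergent[where B = 0]) (auto simp: p_dec)
  then have "p \<longlonglongrightarrow> q"
    by (simp add: LIMSEQ_offset)
  then have "summable (\<lambda>k. p k - p (Suc k))"
    by (rule telescope_summable')
  then have "summable (\<lambda>k. e k + C * (p k - p (Suc k)))"
    by (intro summable_add summable_mult e)
  moreover have "d k \<le> e k + C * (p k - p (Suc k)) + \<epsilon> * W k" if k: "k \<ge> k0" for k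
  proof -
    have nonneg: "0 \<le> W k" "0 \<le> C * (p k - p (Suc k))"
      using p_dec[OF k] pos by (auto simp: W_def sum_nonneg)
    show ?thesis
      using k0(2)[OF k]
    proof
      assume "c * (d k)\<^sup>2 \<le> b * W k * (p k - p (Suc k))"
      also have "b * W k * (p k - p (Suc k)) = c * (4 * (C * (p k - p (Suc k))) * (\<epsilon> * W k))"
        using c pos by (simp add: C_def)
      finally have "(d k)\<^sup>2 \<le> 4 * (C * (p k - p (Suc k))) * (\<epsilon> * W k)"
        using c by simp
      \<comment> \<open>AM-GM in the form \<open>4 * u * v \<le> (u + v)\<^sup>2\<close>.\<close>
      also have "\<dots> \<le> (C * (p k - p (Suc k)) + \<epsilon> * W k)\<^sup>2"
        using zero_le_power2[of "C * (p k - p (Suc k)) - \<epsilon> * W k"]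
        unfolding power2_sum power2_diff by linarith
      finally have "d k \<le> C * (p k - p (Suc k)) + \<epsilon> * W k"
        by (rule power2_le_imp_le) (use nonneg pos in auto)
      then show ?thesis using e(1)[of k] by linarith
    qed (use nonneg pos in \<open>simp add: add_increasing2\<close>)
  qed
  moreover have "0 \<le> e k + C * (p k - p (Suc k))" if "k \<ge> k0" for k
    using p_dec[OF that] e(1)[of k] pos by simp
  moreover have "\<epsilon> * (real (m + 1) + 1) < 1"
    by (simp add: \<epsilon>_def field_simps)
  ultimately show ?thesis
    using pos(1) unfolding W_def
    by (intro summable_of_window_recursion[of d k0 "\<lambda>k. e k + C * (p k - p (Suc k))" \<epsilon> "m + 1"]) auto
qed

lemma norm_diff_le_sum:
  assumes "p \<le> q"
  shows "norm (x q - x p) \<le> (\<Sum>j\<in>{p..<q}. d j)"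
  using norm_sum[of "\<lambda>j. x (Suc j) - x j" "{p..<q}"] sum_Suc_diff'[OF assms, of x]
  by (simp add: d_def)

section \<open>Necessity: summable steps control the gap\<close>

text \<open>The iterates converge to a single \<open>z\<close>, so late ones lie in one convex ball
  inside \<open>N\<close>, and the subgradient inequality holds between any two of them.\<close>

lemma summable_sqrt_gap:
  assumes d: "summable d" and \<rho>: "0 < \<rho>"
    and N: "cluster_points x \<subseteq> interior N" and wc: "weakly_convex_on \<rho> N \<Phi>"
  shows "summable (\<lambda>k. sqrt (L (Suc k) - f (Suc k)))"
proof -
  have "summable (\<lambda>k. x (Suc k) - x k)"
    using d unfolding d_def[abs_def] by (rule summable_norm_cancel)
  then have "convergent (\<lambda>n. \<Sum>k<n. x (Suc k) - x k)"
    by (simp add: summable_iff_convergent)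
  then have "convergent (\<lambda>n. x n - x 0)"
    by (simp add: sum_lessThan_telescope)
  then have "convergent (\<lambda>n. x n - x 0 + x 0)"
    by (intro convergent_add convergent_const)
  then obtain z where z: "x \<longlonglongrightarrow> z"
    by (auto simp: convergent_def)
  then have "z \<in> cluster_points x"
    unfolding cluster_points_def by (auto intro!: exI[of _ id] simp: strict_mono_id)
  then obtain r where r: "0 < r" "ball z r \<subseteq> N"
    using N by (meson mem_interior subsetD)
  \<comment> \<open>Here \<open>m\<close> suffices: the index preceding
    \<open>ell \<Phi> m x (Suc k)\<close> is at least \<open>k - m\<close> for large
    \<open>k\<close>.\<close>
  define W where "W k = (\<Sum>j\<in>window m k. d j)" for k
  have "eventually (\<lambda>k. x k \<in> ball z r) sequentially"
    using z r(1) by (intro topological_tendstoD) auto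
  then obtain k1 where k1: "\<And>k. k \<ge> k1 \<Longrightarrow> x k \<in> ball z r"
    unfolding eventually_sequentially by blast
  \<comment> \<open>In the constant, \<open>b\<close> stems from the subgradient bound with
    Cauchy-Schwarz and \<open>\<rho> / 2\<close> from weak convexity. The margin
    \<open>m + 1\<close> keeps the maximizing index positive and beyond \<open>k1\<close>.\<close>
  have "eventually (\<lambda>k. norm (sqrt (L (Suc k) - f (Suc k))) \<le> sqrt (b + \<rho> / 2) * W k) sequentially"
    using eventually_ge_at_top[of "k1 + m + 1"]
  proof eventually_elim
    case (elim k)
    let ?l = "ell \<Phi> m x (Suc k)"
    define D where "D = norm (x (Suc k) - x ?l)"
    have W: "0 \<le> W k" by (simp add: W_def sum_nonneg)
    have l: "Suc k - m \<le> ?l" "?l \<le> Suc k"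
      using ell_window[of "Suc k"] by (auto simp: window_def)
    have "D \<le> (\<Sum>j\<in>{?l..<Suc k}. d j)"
      unfolding D_def by (rule norm_diff_le_sum[OF l(2)])
    also have "\<dots> \<le> W k"
      unfolding W_def using l elim by (intro sum_mono2) (auto simp: window_def)
    finally have D: "D \<le> W k" "0 \<le> D" by (auto simp: D_def)
    have l': "Suc (?l - 1) = ?l" "?l - 1 \<in> window m k"
      using l elim by (auto simp: window_def)
    then have "norm (w ?l) \<le> b * d (?l - 1)"
      using w_le[of "?l - 1"] by (simp add: d_def)
    also have "\<dots> \<le> b * W k"
      unfolding W_def using b_pos l'(2)
      by (intro mult_left_mono member_le_sum) auto
    finally have wl: "norm (w ?l) \<le> b * W k" .
    have "L (Suc k) + w ?l \<bullet> (x (Suc k) - x ?l) - \<rho> / 2 * D\<^sup>2 \<le> f (Suc k)"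
      unfolding D_def
    proof (rule weakly_convex_limiting_subgradient[OF wc convex_ball open_ball r(2)])
      show "x ?l \<in> ball z r" "x (Suc k) \<in> ball z r"
        using l elim by (auto intro!: k1 simp del: mem_ball)
    qed (auto simp: w_subdiff val f_ell)
    moreover have "- (w ?l \<bullet> (x (Suc k) - x ?l)) \<le> norm (w ?l) * D"
      using Cauchy_Schwarz_ineq2[of "w ?l" "x (Suc k) - x ?l"] by (simp add: D_def)
    moreover have "norm (w ?l) * D \<le> b * W k * W k"
      using wl D W b_pos by (intro mult_mono) auto
    moreover have "\<rho> / 2 * D\<^sup>2 \<le> \<rho> / 2 * (W k)\<^sup>2"
      using D \<rho> by (intro mult_left_mono power_mono) auto
    ultimately have "L (Suc k) - f (Suc k) \<le> (b + \<rho> / 2) * (W k)\<^sup>2"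
      by (simp add: algebra_simps power2_eq_square)
    then have "sqrt (L (Suc k) - f (Suc k)) \<le> sqrt ((b + \<rho> / 2) * (W k)\<^sup>2)"
      by (rule real_sqrt_le_mono)
    then show ?case
      using W le_L[of "Suc k" "Suc k"] by (simp add: real_sqrt_mult)
  qed
  then show ?thesis
    by (rule summable_comparison_test_ev)
      (unfold W_def, intro summable_mult summable_window_sum d, simp)
qed

section \<open>The index set \<open>K1\<close> and two sufficient conditions for summability\<close>

lemma K1_iff: "k \<in> K1 \<Phi> m a x \<longleftrightarrow> a / 2 * (d k)\<^sup>2 \<le> L (Suc k) - f (Suc k)"
  by (simp add: K1_def val f_ell d_def)

lemma decrease_quotient_eq:
  "decrease_quotient \<Phi> m x k = (if d k = 0 then \<infinity> else ereal ((L k - L (Suc k)) / (d k)\<^sup>2))"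
  by (simp add: decrease_quotient_def d_def val f_ell)

text \<open>The rise from \<open>f (Suc k)\<close> to \<open>L (Suc k)\<close> uses up less than
  half of the guaranteed drop \<open>a * (d k)\<^sup>2\<close>; the other half is left for
  \<open>L\<close>.\<close>

lemma decrease_outside_K1:
  assumes "k \<notin> K1 \<Phi> m a x"
  shows "a / 2 * (d k)\<^sup>2 \<le> L k - L (Suc k)"
  using assms L_decrease[of k] by (simp add: K1_iff)

text \<open>The quotients are nonnegative, so a nonzero lower limit is positive; this includes
  \<open>\<infinity>\<close> for finite \<open>K1\<close>.\<close>

lemma summable_if_liminf_nonzero:
  assumes "liminf_along (K1 \<Phi> m a x) (decrease_quotient \<Phi> m x) \<noteq> 0"
  shows "summable d"
proof -
  let ?F = "inf sequentially (principal (K1 \<Phi> m a x))"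
  have "0 \<le> Liminf ?F (decrease_quotient \<Phi> m x)"
    using L_Suc_le by (intro Liminf_bounded always_eventually) (simp add: decrease_quotient_eq)
  then have "0 < Liminf ?F (decrease_quotient \<Phi> m x)"
    using assms by (simp add: liminf_along_def order_less_le)
  then obtain c where c: "0 < ereal c" "ereal c < Liminf ?F (decrease_quotient \<Phi> m x)"
    using ereal_dense3 by blast
  from less_LiminfD[OF c(2)]
  have "eventually (\<lambda>k. k \<in> K1 \<Phi> m a x \<longrightarrow> ereal c < decrease_quotient \<Phi> m x k) sequentially"
    by (simp add: eventually_inf_principal)
  \<comment> \<open>The minimum merges the constant \<open>c\<close> on \<open>K1\<close> with
    \<open>a / 2\<close> outside; \<open>d k \<le> 0\<close> handles zero steps, where the quotient
    is \<open>\<infinity>\<close> by convention.\<close>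
  then have "eventually (\<lambda>k. d k \<le> 0 \<or> min c (a / 2) * (d k)\<^sup>2 \<le> L k - L (Suc k)) sequentially"
  proof eventually_elim
    case (elim k)
    have min: "min c (a / 2) * (d k)\<^sup>2 \<le> c * (d k)\<^sup>2" "min c (a / 2) * (d k)\<^sup>2 \<le> a / 2 * (d k)\<^sup>2"
      by (intro mult_right_mono; simp)+
    show ?case
    proof (cases "k \<in> K1 \<Phi> m a x \<and> d k \<noteq> 0")
      case True
      with elim have "c < (L k - L (Suc k)) / (d k)\<^sup>2"
        by (simp add: decrease_quotient_eq)
      then have "c * (d k)\<^sup>2 < L k - L (Suc k)"
        using True by (simp add: field_simps)
      then show ?thesis using min by linarith
    next
      case False
      then show ?thesis
        using min decrease_outside_K1[of k] by (auto intro: order_trans)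
    qed
  qed
  then show ?thesis
    by (intro summable_steps[of "min c (a / 2)" "\<lambda>_. 0"]) (use c a_pos in auto)
qed

text \<open>On \<open>K1\<close> the defining inequality bounds \<open>d k\<close> by
  \<open>sqrt (2 / a)\<close> times the root of the gap; elsewhere the decrease is
  quadratic.\<close>

lemma summable_if_sqrt_gap_summable:
  assumes "(\<lambda>k. sqrt (L (Suc k) - f (Suc k))) summable_on K1 \<Phi> m a x"
  shows "summable d"
proof -
  let ?g = "\<lambda>k. if k \<in> K1 \<Phi> m a x then sqrt (L (Suc k) - f (Suc k)) else 0"
  have nonneg: "0 \<le> ?g k" for k
    using le_L[of "Suc k" "Suc k"] by simp
  have "?g summable_on UNIV"
    using assms by (rule summable_on_cong_neutral[THEN iffD1, rotated -1]) auto
  then have "summable ?g"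
    using nonneg by (simp add: summable_on_UNIV_nonneg_real_iff)
  then have "summable (\<lambda>k. sqrt (2 / a) * ?g k)"
    by (rule summable_mult)
  moreover have "d k \<le> sqrt (2 / a) * ?g k \<or> a / 2 * (d k)\<^sup>2 \<le> L k - L (Suc k)" for k
  proof (cases "k \<in> K1 \<Phi> m a x")
    case True
    then have "(d k)\<^sup>2 \<le> 2 / a * (L (Suc k) - f (Suc k))"
      using a_pos by (simp add: K1_iff field_simps)
    then have "sqrt ((d k)\<^sup>2) \<le> sqrt (2 / a * (L (Suc k) - f (Suc k)))"
      by (rule real_sqrt_le_mono)
    then show ?thesis
      unfolding real_sqrt_mult using True by simp
  qed (use decrease_outside_K1[of k] in simp)
  ultimately show ?thesis
    using nonneg a_pos
    by (intro summable_steps[of "a / 2" "\<lambda>k. sqrt (2 / a) * ?g k"]) (auto simp del: if_split)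
qed

end

theorem proposition3p5:
  fixes \<Phi> :: "'a::euclidean_space \<Rightarrow> ereal"
    and m :: nat
    and a b :: real
    and x :: "nat \<Rightarrow> 'a"
  assumes "proper \<Phi>" and "lsc \<Phi>" and "coercive \<Phi>" and "bounded_from_below \<Phi>"
    and "a > 0" and "b > 0"
    and H1: "\<forall>k. \<Phi> (x (Suc k)) + ereal (a * (norm (x (Suc k) - x k))\<^sup>2)
                 \<le> Max ((\<lambda>j. \<Phi> (x j)) ` window m k)"
    and H2: "\<exists>w. \<forall>k. w k \<in> limiting_subdiff \<Phi> (x k) \<and>
                 norm (w (Suc k)) \<le> b * norm (x (Suc k) - x k)"
    and "KL_function \<Phi>"
    and "liminf (\<lambda>k. \<Phi> (x k)) \<ge> lim (\<lambda>k. \<Phi> (x (ell \<Phi> m x k)))"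
    and "\<forall>r z. strict_mono r \<and> (x \<circ> r) \<longlonglongrightarrow> z \<longrightarrow> limsup (\<lambda>j. \<Phi> (x (r j))) \<le> \<Phi> z"
    and "\<exists>\<rho>>0. \<exists>N. cluster_points x \<subseteq> interior N \<and> weakly_convex_on \<rho> N \<Phi>"
  shows "summable (\<lambda>k. norm (x (Suc k) - x k)) \<longleftrightarrow>
         (liminf_along (K1 \<Phi> m a x) (decrease_quotient \<Phi> m x) = 0 \<longrightarrow>
          (\<lambda>k. sqrt (real_of_ereal (\<Phi> (x (ell \<Phi> m x (Suc k))) - \<Phi> (x (Suc k)))))
            summable_on K1 \<Phi> m a x)"
proof -
  from H2 obtain w where w: "\<And>k. w k \<in> limiting_subdiff \<Phi> (x k)"
    "\<And>k. norm (w (Suc k)) \<le> b * norm (x (Suc k) - x k)"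
    by blast
  define f where "f k = real_of_ereal (\<Phi> (x k))" for k
  have val: "\<Phi> (x k) = ereal (f k)" for k
  proof -
    \<comment> \<open>Limiting subgradients exist only in the effective domain; properness excludes
      \<open>- \<infinity>\<close>.\<close>
    have "\<Phi> (x k) < \<infinity>" "\<Phi> (x k) \<noteq> - \<infinity>"
      using w(1)[of k] \<open>proper \<Phi>\<close> by (auto simp: limiting_subdiff_def edom_def proper_def)
    then show ?thesis by (cases "\<Phi> (x k)") (auto simp: f_def)
  qed
  interpret nonmonotone_descent \<Phi> m a b x w f
  proof
    fix k
    have "Max ((\<lambda>j. \<Phi> (x j)) ` window m k) \<in> (\<lambda>j. \<Phi> (x j)) ` window m k"
      by (intro Max_in) (auto simp: window_def)
    then obtain j where j: "j \<in> window m k" "Max ((\<lambda>j. \<Phi> (x j)) ` window m k) = ereal (f j)"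
      by (auto simp: val)
    have "f (Suc k) + a * (norm (x (Suc k) - x k))\<^sup>2 \<le> f j"
      using H1[rule_format, of k] unfolding j(2) by (simp add: val)
    also have "\<dots> \<le> Max (f ` window m k)"
      using j(1) by (intro Max_ge) (auto simp: window_def)
    finally show "f (Suc k) + a * (norm (x (Suc k) - x k))\<^sup>2 \<le> Max (f ` window m k)" .
  qed (use assms w val in auto)
  have gap: "sqrt (real_of_ereal (\<Phi> (x (ell \<Phi> m x (Suc k))) - \<Phi> (x (Suc k)))) =
      sqrt (L (Suc k) - f (Suc k))" for k
    by (simp add: val f_ell)
  have gap_nonneg: "0 \<le> sqrt (L (Suc k) - f (Suc k))" for k
    using le_L[of "Suc k" "Suc k"] by simp
  have "(\<lambda>k. sqrt (L (Suc k) - f (Suc k))) summable_on K1 \<Phi> m a x" if "summable d"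
  proof -
    have "summable (\<lambda>k. sqrt (L (Suc k) - f (Suc k)))"
      using assms(12) summable_sqrt_gap[OF that] by blast
    \<comment> \<open>Nonnegativity makes the series unconditionally summable, hence summable on any
      subset.\<close>
    then have "(\<lambda>k. sqrt (L (Suc k) - f (Suc k))) summable_on UNIV"
      using gap_nonneg by (simp add: summable_on_UNIV_nonneg_real_iff)
    then show ?thesis
      by (rule summable_on_subset_banach) simp
  qed
  \<comment> \<open>For the converse, either the lower limit is nonzero or the condition makes the
    gap sum finite; each case gives summable steps.\<close>
  then show ?thesis
    using summable_if_liminf_nonzero summable_if_sqrt_gap_summable
    unfolding gap d_def[abs_def] by blast
qed

end
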